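(* Let $\mathcal{C}$ be a majority minimal clone with finitely many ternary operations (i.e. $\mathcal{C}^{(3)}$ is finite). If every nontrivial ternary operation in $\mathcal{C}$ is cyclically symmetric, then $\mathcal{C}$ contains only one nontrivial ternary operation, and hence $\mathcal{C}^{(3)}\cong [m_1]^{(3)}$.
   Context: An (abstract) clone $\mathcal{C}$ is given by a family of sets $\mathcal{C}^{(n)}$ ($n\ge 1$), distinguished elements $e_i^{(n)}\in\mathcal{C}^{(n)}$ ($1\le i\le n$, the projections), and composition maps $F^n_k:\mathcal{C}^{(n)}\times(\mathcal{C}^{(k)})^n\to\mathcal{C}^{(k)}$, $(f,g_1,\dots,g_n)\mapsto f(g_1,\dots,g_n)$ ($n,k\ge1$), satisfying $e_i^{(n)}(g_1,\dots,g_n)=g_i$, $f(e_1^{(n)},\dots,e_n^{(n)})=f$, and $f(g_1,\dots,g_n)(h_1,\dots,h_k)=f(g_1(h_1,\dots,h_k),\dots,g_n(h_1,\dots,h_k))$ for all $f\in\mathcal{C}^{(n)}$, $g_i\in\mathcal{C}^{(k)}$, $h_j\in\mathcal{C}^{(l)}$. A concrete clone (a set of finitary operations on a set, containing all projections and closed under composition) is an abstract clone in the obvious way, and every abstract clone is isomorphic to a concrete one. Elements of $\mathcal{C}^{(n)}$ are called $n$-ary operations of $\mathcal{C}$. $[f]$ denotes the (sub)clone generated by $f$. Projections are called trivial operations, all other elements of $\mathcal{C}$ nontrivial; the trivial clone is the one consisting of projections only. $\mathcal{C}$ is minimal if it has exactly two subclones: the trivial one (consisting of the projections) and $\mathcal{C}$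 itself. An element $f\in\mathcal{C}^{(3)}$ is a majority operation if it satisfies $f(x,x,y)=f(x,y,x)=f(y,x,x)=x$ identically, i.e. $f(e_1^{(2)},e_1^{(2)},e_2^{(2)})=f(e_1^{(2)},e_2^{(2)},e_1^{(2)})=f(e_2^{(2)},e_1^{(2)},e_1^{(2)})=e_1^{(2)}$ in $\mathcal{C}^{(2)}$. A majority clone is a clone $\mathcal{C}=[f]$ with $f$ a majority operation; a majority minimal clone is a majority clone that is minimal. An operation $f\in\mathcal{C}^{(3)}$ is cyclically symmetric if it is invariant under all cyclic permutations of its variables, i.e. $f(e_2^{(3)},e_3^{(3)},e_1^{(3)})=f$ (equivalently, the stabilizer of $f$ under permutation of variables by $S_3$ contains $A_3$). The ternary part of $\mathcal{C}$, also denoted $\mathcal{C}^{(3)}$, is the algebra $(\mathcal{C}^{(3)};F^3_3,e_1^{(3)},e_2^{(3)},e_3^{(3)})$ with one quaternary and three nullary operations; $\cong$ between ternary parts means isomorphism of such algebras. $m_1$ is the majority operation on $\{1,2,3\}$ with $m_1(a,b,c)=1$ whenever $a,b,c$ are pairwise distinct; $[m_1]$ is the clone on $\{1,2,3\}$ it generates. *)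

theory Defs
  imports "HOL-Library.FuncSet"
begin

section \<open>Abstract clones\<close>

definition tuples :: "'a set \<Rightarrow> nat \<Rightarrow> 'a list set" where
  "tuples A n = {xs. length xs = n \<and> set xs \<subseteq> A}"

text \<open>
  In \<open>clone_comp C n k f [g\<^sub>1, \<dots>, g\<^sub>n]\<close> the operation \<open>f\<close> has arity \<open>n\<close> and the \<open>g\<^sub>i\<close> have
  arity \<open>k\<close>.  The sets \<open>ops C n\<close> need not be disjoint, so arities are always given explicitly.
  Projections \<open>proj C n i\<close> are indexed by \<open>1 \<le> i \<le> n\<close>.
\<close>

record 'a clone =
  ops :: "nat \<Rightarrow> 'a set"
  proj :: "nat \<Rightarrow> nat \<Rightarrow> 'a"
  clone_comp :: "nat \<Rightarrow> nat \<Rightarrow> 'a \<Rightarrow> 'a list \<Rightarrow> 'a"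

text \<open>
  Arities are positive; \<open>no_nullary\<close> only normalises the unused entry at index 0, so that two
  families of sets indexed by the positive arities are equal iff they are equal as functions.
\<close>

locale abstract_clone =
  fixes C :: "'a clone"
  assumes no_nullary: "ops C 0 = {}"
    and proj_in: "1 \<le> i \<Longrightarrow> i \<le> n \<Longrightarrow> proj C n i \<in> ops C n"
    and comp_in: "n \<ge> 1 \<Longrightarrow> k \<ge> 1 \<Longrightarrow> f \<in> ops C n \<Longrightarrow> gs \<in> tuples (ops C k) n \<Longrightarrow>
      clone_comp C n k f gs \<in> ops C k"
    and proj_comp: "1 \<le> i \<Longrightarrow> i \<le> n \<Longrightarrow> k \<ge> 1 \<Longrightarrow> gs \<in> tuples (ops C k) n \<Longrightarrow>
      clone_comp C n k (proj C n i) gs = gs ! (i - 1)"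
    and comp_proj: "n \<ge> 1 \<Longrightarrow> f \<in> ops C n \<Longrightarrow>
      clone_comp C n n f (map (proj C n) [1..<Suc n]) = f"
    and comp_assoc: "n \<ge> 1 \<Longrightarrow> k \<ge> 1 \<Longrightarrow> l \<ge> 1 \<Longrightarrow>
      f \<in> ops C n \<Longrightarrow> gs \<in> tuples (ops C k) n \<Longrightarrow> hs \<in> tuples (ops C l) k \<Longrightarrow>
      clone_comp C k l (clone_comp C n k f gs) hs =
      clone_comp C n l f (map (\<lambda>g. clone_comp C k l g hs) gs)"

definition trivial_ops :: "'a clone \<Rightarrow> nat \<Rightarrow> 'a set" where
  "trivial_ops C n = {proj C n i | i. 1 \<le> i \<and> i \<le> n}"

definition nontrivial_ops :: "'a clone \<Rightarrow> nat \<Rightarrow> 'a set" where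
  "nontrivial_ops C n = ops C n - trivial_ops C n"

definition subclone :: "'a clone \<Rightarrow> (nat \<Rightarrow> 'a set) \<Rightarrow> bool" where
  "subclone C D \<longleftrightarrow>
    (\<forall>n. D n \<subseteq> ops C n) \<and>
    (\<forall>n i. 1 \<le> i \<and> i \<le> n \<longrightarrow> proj C n i \<in> D n) \<and>
    (\<forall>n k f gs. n \<ge> 1 \<and> k \<ge> 1 \<and> f \<in> D n \<and> gs \<in> tuples (D k) n \<longrightarrow>
       clone_comp C n k f gs \<in> D k)"

definition generated :: "'a clone \<Rightarrow> nat \<Rightarrow> 'a \<Rightarrow> nat \<Rightarrow> 'a set" where
  "generated C n f k = \<Inter>{D k | D. subclone C D \<and> f \<in> D n}"

definition minimal_clone :: "'a clone \<Rightarrow> bool" where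
  "minimal_clone C \<longleftrightarrow>
    {D. subclone C D} = {trivial_ops C, ops C} \<and> trivial_ops C \<noteq> ops C"


section \<open>Majority operations and cyclic symmetry\<close>

definition is_majority :: "'a clone \<Rightarrow> 'a \<Rightarrow> bool" where
  "is_majority C f \<longleftrightarrow> f \<in> ops C 3 \<and>
    (let x = proj C 2 1; y = proj C 2 2 in
       clone_comp C 3 2 f [x, x, y] = x \<and>
       clone_comp C 3 2 f [x, y, x] = x \<and>
       clone_comp C 3 2 f [y, x, x] = x)"

definition majority_clone :: "'a clone \<Rightarrow> bool" where
  "majority_clone C \<longleftrightarrow> (\<exists>f. is_majority C f \<and> ops C = generated C 3 f)"

definition cyclically_symmetric :: "'a clone \<Rightarrow> 'a \<Rightarrow> bool" where
  "cyclically_symmetric C f \<longleftrightarrow>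
    clone_comp C 3 3 f [proj C 3 2, proj C 3 3, proj C 3 1] = f"


section \<open>Ternary parts\<close>

record 'a ternary_algebra =
  t_carrier :: "'a set"
  t_comp :: "'a \<Rightarrow> 'a \<Rightarrow> 'a \<Rightarrow> 'a \<Rightarrow> 'a"
  t_e1 :: 'a
  t_e2 :: 'a
  t_e3 :: 'a

definition ternary_part :: "'a clone \<Rightarrow> 'a ternary_algebra" where
  "ternary_part C =
    \<lparr> t_carrier = ops C 3,
      t_comp = (\<lambda>f g1 g2 g3. clone_comp C 3 3 f [g1, g2, g3]),
      t_e1 = proj C 3 1, t_e2 = proj C 3 2, t_e3 = proj C 3 3 \<rparr>"

definition ternary_isomorphic :: "'a ternary_algebra \<Rightarrow> 'b ternary_algebra \<Rightarrow> bool" where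
  "ternary_isomorphic P Q \<longleftrightarrow>
    (\<exists>\<phi>. bij_betw \<phi> (t_carrier P) (t_carrier Q) \<and>
       (\<forall>f\<in>t_carrier P. \<forall>g1\<in>t_carrier P. \<forall>g2\<in>t_carrier P. \<forall>g3\<in>t_carrier P.
          \<phi> (t_comp P f g1 g2 g3) = t_comp Q (\<phi> f) (\<phi> g1) (\<phi> g2) (\<phi> g3)) \<and>
       \<phi> (t_e1 P) = t_e1 Q \<and> \<phi> (t_e2 P) = t_e2 Q \<and> \<phi> (t_e3 P) = t_e3 Q)"


section \<open>Concrete clones\<close>

text \<open>
  The clone of all finitary operations on \<open>A\<close>.  An \<open>n\<close>-ary operation is a function on lists that is
  undefined outside \<open>tuples A n\<close>, so that distinct functions are distinct operations.
\<close>

definition full_clone :: "'b set \<Rightarrow> ('b list \<Rightarrow> 'b) clone" where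
  "full_clone A =
    \<lparr> ops = (\<lambda>n. if n = 0 then {} else tuples A n \<rightarrow>\<^sub>E A),
      proj = (\<lambda>n i. \<lambda>xs\<in>tuples A n. xs ! (i - 1)),
      clone_comp = (\<lambda>n k f gs. \<lambda>xs\<in>tuples A k. f (map (\<lambda>g. g xs) gs)) \<rparr>"

definition concrete_clone_gen :: "'b set \<Rightarrow> nat \<Rightarrow> ('b list \<Rightarrow> 'b) \<Rightarrow> ('b list \<Rightarrow> 'b) clone" where
  "concrete_clone_gen A n f = (full_clone A) \<lparr> ops := generated (full_clone A) n f \<rparr>"

definition m1 :: "nat list \<Rightarrow> nat" where
  "m1 = (\<lambda>xs\<in>tuples {1, 2, 3} 3.
     if xs ! 0 = xs ! 1 \<or> xs ! 0 = xs ! 2 then xs ! 0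
     else if xs ! 1 = xs ! 2 then xs ! 1
     else 1)"

lemma abstract_clone_full_clone: "abstract_clone (full_clone A)"
proof
  fix n and f :: "'a list \<Rightarrow> 'a" assume n: "1 \<le> n" and f: "f \<in> ops (full_clone A) n"
  have *: "map (\<lambda>g. g xs) (map (proj (full_clone A) n) [1..<Suc n]) = xs"
    if "xs \<in> tuples A n" for xs
    using that by (intro nth_equalityI) (auto simp: full_clone_def tuples_def simp del: upt_Suc)
  show "clone_comp (full_clone A) n n f (map (proj (full_clone A) n) [1..<Suc n]) = f"
  proof
    fix xs
    show "clone_comp (full_clone A) n n f (map (proj (full_clone A) n) [1..<Suc n]) xs = f xs"
      using f n * [of xs]
      by (cases "xs \<in> tuples A n") (auto simp: full_clone_def PiE_def extensional_def simp del: upt_Suc)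
  qed
next
  fix i n k :: nat and gs assume *: "1 \<le> i" "i \<le> n" "k \<ge> 1" "gs \<in> tuples (ops (full_clone A) k) n"
  then have "gs ! (i - 1) \<in> set gs" "set gs \<subseteq> ops (full_clone A) k"
    by (auto simp: tuples_def)
  with * have "gs ! (i - 1) \<in> tuples A k \<rightarrow>\<^sub>E A"
    by (auto simp: full_clone_def split: if_splits)
  note gs_i = this
  show "clone_comp (full_clone A) n k (proj (full_clone A) n i) gs = gs ! (i - 1)"
  proof (intro ext)
    fix xs
    show "clone_comp (full_clone A) n k (proj (full_clone A) n i) gs xs = (gs ! (i - 1)) xs"
    proof (cases "xs \<in> tuples A k")
      case True
      with * have "map (\<lambda>g. g xs) gs \<in> tuples A n"
        by (auto simp: full_clone_def tuples_def)
      with True * show ?thesis by (simp add: full_clone_def tuples_def)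
    next
      case False
      with gs_i show ?thesis
        by (simp add: full_clone_def PiE_arb[of _ _ "\<lambda>_. A"])
    qed
  qed
next
  fix n k l :: nat and f gs hs
  assume *: "n \<ge> 1" "k \<ge> 1" "l \<ge> 1" "f \<in> ops (full_clone A) n"
    "gs \<in> tuples (ops (full_clone A) k) n" "hs \<in> tuples (ops (full_clone A) l) k"
  then have "map (\<lambda>h. h xs) hs \<in> tuples A k" if "xs \<in> tuples A l" for xs
    using that by (auto simp: full_clone_def tuples_def)
  then show "clone_comp (full_clone A) k l (clone_comp (full_clone A) n k f gs) hs =
      clone_comp (full_clone A) n l f (map (\<lambda>g. clone_comp (full_clone A) k l g hs) gs)"
    by (auto simp: full_clone_def fun_eq_iff restrict_def o_def)
next
  fix i n :: nat assume "1 \<le> i" "i \<le> n"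
  then show "proj (full_clone A) n i \<in> ops (full_clone A) n"
    by (auto simp: full_clone_def tuples_def)
next
  fix n k :: nat and f gs
  assume *: "n \<ge> 1" "k \<ge> 1" "f \<in> ops (full_clone A) n" "gs \<in> tuples (ops (full_clone A) k) n"
  have "f (map (\<lambda>g. g xs) gs) \<in> A" if "xs \<in> tuples A k" for xs
  proof -
    have "map (\<lambda>g. g xs) gs \<in> tuples A n"
      using * that by (auto simp: full_clone_def tuples_def)
    moreover have "f \<in> tuples A n \<rightarrow>\<^sub>E A" using * by (simp add: full_clone_def)
    ultimately show ?thesis by blast
  qed
  then show "clone_comp (full_clone A) n k f gs \<in> ops (full_clone A) k"
    using * by (simp add: full_clone_def)
qed (simp add: full_clone_def)

lemma (in abstract_clone) subclone_self: "subclone C (ops C)"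
  by (simp add: subclone_def proj_in comp_in)

lemma (in abstract_clone) subclone_generated:
  assumes "f \<in> ops C n"
  shows "subclone C (generated C n f)" and "f \<in> generated C n f n"
proof -
  have "generated C n f k \<subseteq> ops C k" for k
    using assms subclone_self by (auto simp: generated_def)
  moreover have "proj C m i \<in> generated C n f m" if "1 \<le> i" "i \<le> m" for m i
    using that by (auto simp: generated_def subclone_def)
  moreover have "clone_comp C m k g hs \<in> generated C n f k"
    if *: "m \<ge> 1" "k \<ge> 1" "g \<in> generated C n f m" "hs \<in> tuples (generated C n f k) m" for m k g hs
  proof -
    have "clone_comp C m k g hs \<in> D k" if D: "subclone C D" "f \<in> D n" for D
    proof -
      have "g \<in> D m" "hs \<in> tuples (D k) m"
        using * D by (auto simp: generated_def tuples_def)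
      then show ?thesis using D(1) * by (simp add: subclone_def)
    qed
    then show ?thesis by (auto simp: generated_def)
  qed
  ultimately show "subclone C (generated C n f)" by (simp add: subclone_def)
  show "f \<in> generated C n f n" by (auto simp: generated_def)
qed

lemma (in abstract_clone) abstract_clone_subclone:
  assumes "subclone C D"
  shows "abstract_clone (C \<lparr> ops := D \<rparr>)"
proof -
  have sub: "D n \<subseteq> ops C n" for n using assms by (simp add: subclone_def)
  then have tup: "gs \<in> tuples (D k) n \<Longrightarrow> gs \<in> tuples (ops C k) n" for gs k n
    by (force simp: tuples_def)
  have proj: "clone_comp C n k (proj C n i) gs = gs ! (i - 1)"
    if "1 \<le> i" "i \<le> n" "k \<ge> 1" "gs \<in> tuples (D k) n" for n k i gs
    using that by (intro proj_comp tup)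
  have id: "clone_comp C n n f (map (proj C n) [1..<Suc n]) = f" if "n \<ge> 1" "f \<in> D n" for n f
    using that sub by (intro comp_proj) auto
  have assoc: "clone_comp C k l (clone_comp C n k f gs) hs =
      clone_comp C n l f (map (\<lambda>g. clone_comp C k l g hs) gs)"
    if "n \<ge> 1" "k \<ge> 1" "l \<ge> 1" "f \<in> D n" "gs \<in> tuples (D k) n" "hs \<in> tuples (D l) k"
    for n k l f gs hs
    using that sub by (intro comp_assoc tup) auto
  have "D 0 = {}" using sub [of 0] no_nullary by simp
  moreover have "proj C n i \<in> D n" if "1 \<le> i" "i \<le> n" for n i
    using assms that by (simp add: subclone_def)
  moreover have "clone_comp C n k f gs \<in> D k"
    if "n \<ge> 1" "k \<ge> 1" "f \<in> D n" "gs \<in> tuples (D k) n" for n k f gs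
    using assms that by (simp add: subclone_def)
  moreover have "ops (C\<lparr>ops := D\<rparr>) = D" "proj (C\<lparr>ops := D\<rparr>) = proj C"
    "clone_comp (C\<lparr>ops := D\<rparr>) = clone_comp C"
    by simp_all
  ultimately show ?thesis
    using proj id assoc by (intro abstract_clone.intro; simp only:)
qed

lemma abstract_clone_concrete_clone_gen:
  assumes "f \<in> ops (full_clone A) n"
  shows "abstract_clone (concrete_clone_gen A n f)"
proof -
  interpret abstract_clone "full_clone A" by (rule abstract_clone_full_clone)
  show ?thesis
    unfolding concrete_clone_gen_def
    by (intro abstract_clone_subclone subclone_generated assms)
qed

lemma is_majority_m1: "is_majority (full_clone {1, 2, 3}) m1"
  by (auto simp: is_majority_def full_clone_def m1_def tuples_def Let_def fun_eq_iff
      eval_nat_numeral length_Suc_conv)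

lemma m1_distinct:
  assumes "{a, b, c} = {1, 2, 3::nat}"
  shows "m1 [a, b, c] = 1"
proof -
  have "card {a, b, c} = 3" using assms by simp
  then have "distinct [a, b, c]" by (intro card_distinct) simp
  then show ?thesis using assms by (auto simp: m1_def tuples_def)
qed

end

theory Submission
  imports Defs
begin

text \<open>
  Majority operations are nontrivial, hence cyclically symmetric, and the set \<open>M\<close> of them is closed
  under \<open>(t \<bullet> g)(x, y, z) = t(x, g(x, y, z), g(x, z, y))\<close>, which is associative.  As \<open>M\<close> is finite,
  it contains an idempotent \<open>g = g \<bullet> g\<close>.  Writing \<open>u = g(x, y, z)\<close> and \<open>v = g(x, z, y)\<close>, idempotence
  says \<open>g(x, u, v) = u\<close> and \<open>g(x, v, u) = v\<close>, so that evaluating \<open>g = g \<bullet> g\<close> at \<open>(v, x, u)\<close> and using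
  cyclic symmetry yields \<open>u = g(v, x, u) = g(v, g(v, x, u), g(v, u, x)) = g(v, u, v) = v\<close>.  Hence \<open>g\<close> is
  totally symmetric.  The totally symmetric members of \<open>M\<close> form a finite semigroup under
  \<open>(t * g)(x, y, z) = t(x, y, g(x, y, z))\<close>; for an idempotent \<open>f\<close> of it, the set of the three
  projections and \<open>f\<close> is closed under \<open>f\<close>, with the same composition table as for \<open>m\<^sub>1\<close>.  By
  minimality \<open>f\<close> generates the clone, so this set is the whole ternary part.
\<close>

section \<open>Idempotents of finite semigroups\<close>

text \<open>Induction on \<open>A\<close>: it suffices to find a proper nonempty subsemigroup. For a
  chosen \<open>a\<close> the candidates are the image of \<open>A\<close> under left multiplication
  by \<open>a\<close> and the set of all \<open>x\<close> with \<open>m a x = a\<close>; if neither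
  is proper, \<open>a\<close> itself is idempotent.\<close>

lemma finite_semigroup_idempotent:
  assumes "finite A" "A \<noteq> {}"
    and "\<And>a b. a \<in> A \<Longrightarrow> b \<in> A \<Longrightarrow> m a b \<in> A"
    and "\<And>a b c. a \<in> A \<Longrightarrow> b \<in> A \<Longrightarrow> c \<in> A \<Longrightarrow> m (m a b) c = m a (m b c)"
  shows "\<exists>a\<in>A. m a a = a"
  using assms
proof (induction rule: finite_psubset_induct)
  case (psubset A)
  note closed = psubset.prems(2) and assoc = psubset.prems(3)
  obtain a where a: "a \<in> A" using psubset.prems(1) by auto
  have sub: ?case if B: "B \<subset> A" "B \<noteq> {}" "\<And>b c. b \<in> B \<Longrightarrow> c \<in> B \<Longrightarrow> m b c \<in> B" for B
  proof -
    have "\<exists>b\<in>B. m b b = b"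
      using B by (intro psubset.IH) (auto intro: assoc)
    with B show ?thesis by blast
  qed
  show ?case
  proof (cases "m a ` A = A")
    case False
    show ?thesis
    proof (rule sub)
      show "m a ` A \<subset> A" using False a closed by blast
      show "m a ` A \<noteq> {}" using a by blast
      show "m b c \<in> m a ` A" if "b \<in> m a ` A" "c \<in> m a ` A" for b c
        using that a closed assoc by (auto intro!: imageI)
    qed
  next
    case True
    \<comment> \<open>Left multiplication by \<open>a\<close> is onto in this case, so it attains
      the value \<open>a\<close>.\<close>
    then have ne: "{x \<in> A. m a x = a} \<noteq> {}" using a by force
    show ?thesis
    proof (cases "{x \<in> A. m a x = a} = A")
      case True
      with a show ?thesis by blast
    next
      case False
      show ?thesis
      proof (rule sub)
        show "{x \<in> A. m a x = a} \<subset> A" using False by blast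
        show "m b c \<in> {x \<in> A. m a x = a}"
          if "b \<in> {x \<in> A. m a x = a}" "c \<in> {x \<in> A. m a x = a}" for b c
          using that a closed by (auto simp flip: assoc)
      qed (rule ne)
    qed
  qed
qed

section \<open>Composition of ternary operations\<close>

lemma tuples_3_iff: "xs \<in> tuples A 3 \<longleftrightarrow> (\<exists>a\<in>A. \<exists>b\<in>A. \<exists>c\<in>A. xs = [a, b, c])"
  by (auto simp: tuples_def eval_nat_numeral length_Suc_conv)

lemma trivial_ops_3: "trivial_ops C 3 = {proj C 3 1, proj C 3 2, proj C 3 3}"
proof -
  have "1 \<le> i \<and> i \<le> 3 \<longleftrightarrow> i = 1 \<or> i = 2 \<or> i = 3" for i :: nat by auto
  then show ?thesis by (auto simp: trivial_ops_def)
qed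

context abstract_clone
begin

abbreviation app3 :: "nat \<Rightarrow> 'a \<Rightarrow> 'a \<Rightarrow> 'a \<Rightarrow> 'a \<Rightarrow> 'a" where
  "app3 k f a b c \<equiv> clone_comp C 3 k f [a, b, c]"

abbreviation "e1 \<equiv> proj C 3 1"
abbreviation "e2 \<equiv> proj C 3 2"
abbreviation "e3 \<equiv> proj C 3 3"

text \<open>The variant with \<open>Suc 0\<close> is present because the simplifier rewrites
  \<open>1\<close> to \<open>Suc 0\<close>.\<close>

lemma e_in [simp]: "e1 \<in> ops C 3" "proj C 3 (Suc 0) \<in> ops C 3" "e2 \<in> ops C 3" "e3 \<in> ops C 3"
  by (auto intro: proj_in)

lemma app3_in [simp]:
  "k \<ge> 1 \<Longrightarrow> f \<in> ops C 3 \<Longrightarrow> a \<in> ops C k \<Longrightarrow> b \<in> ops C k \<Longrightarrow> c \<in> ops C k \<Longrightarrow> app3 k f a b c \<in> ops C k"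
  by (intro comp_in) (auto simp: tuples_3_iff)

lemma app3_e [simp]:
  assumes "k \<ge> 1" "a \<in> ops C k" "b \<in> ops C k" "c \<in> ops C k"
  shows "app3 k e1 a b c = a" "app3 k (proj C 3 (Suc 0)) a b c = a"
    "app3 k e2 a b c = b" "app3 k e3 a b c = c"
  using assms by (simp_all add: proj_comp tuples_3_iff)

lemma app3_id [simp]: "f \<in> ops C 3 \<Longrightarrow> app3 3 f e1 e2 e3 = f" "f \<in> ops C 3 \<Longrightarrow> app3 3 f (proj C 3 (Suc 0)) e2 e3 = f"
  using comp_proj[of 3 f] by (simp_all add: eval_nat_numeral)

lemma app3_assoc:
  assumes "k \<ge> 1" "f \<in> ops C 3" "a \<in> ops C 3" "b \<in> ops C 3" "c \<in> ops C 3"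
    "p \<in> ops C k" "q \<in> ops C k" "r \<in> ops C k"
  shows "app3 k (app3 3 f a b c) p q r =
    app3 k f (app3 k a p q r) (app3 k b p q r) (app3 k c p q r)"
  using assms by (subst comp_assoc) (auto simp: tuples_3_iff)

lemma majority_in: "is_majority C f \<Longrightarrow> f \<in> ops C 3"
  by (simp add: is_majority_def)

text \<open>The majority identities are postulated for the two binary projections only; substituting
  \<open>a\<close> and \<open>b\<close> for these carries the identities over to every
  arity.\<close>

lemma app3_majority:
  assumes f: "is_majority C f" and k: "k \<ge> 1" and a: "a \<in> ops C k" and b: "b \<in> ops C k"
  shows "app3 k f a a b = a" "app3 k f a b a = a" "app3 k f b a a = a"
proof -
  let ?x = "proj C 2 1" and ?y = "proj C 2 2"
  have xy: "?x \<in> ops C 2" "?y \<in> ops C 2" by (auto intro: proj_in)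
  have t: "[a, b] \<in> tuples (ops C k) 2" using a b by (simp add: tuples_def)
  have ev: "clone_comp C 2 k ?x [a, b] = a" "clone_comp C 2 k ?y [a, b] = b"
    using k t by (simp_all add: proj_comp)
  have "clone_comp C 2 k (app3 2 f p q r) [a, b] =
      app3 k f (clone_comp C 2 k p [a, b]) (clone_comp C 2 k q [a, b]) (clone_comp C 2 k r [a, b])"
    if "p \<in> ops C 2" "q \<in> ops C 2" "r \<in> ops C 2" for p q r
    using that t k majority_in[OF f] by (subst comp_assoc) (auto simp: tuples_3_iff)
  note * = this[OF xy(1,1,2)] this[OF xy(1,2,1)] this[OF xy(2,1,1)]
  have "app3 2 f ?x ?x ?y = ?x" "app3 2 f ?x ?y ?x = ?x" "app3 2 f ?y ?x ?x = ?x"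
    using f by (simp_all add: is_majority_def Let_def)
  note ** = *[unfolded this ev, symmetric]
  show "app3 k f a a b = a" "app3 k f a b a = a" "app3 k f b a a = a"
    by (fact **)+
qed

section \<open>Bounding the generated ternary operations\<close>

text \<open>The operations of any arity that send tuples over \<open>S\<close> into \<open>S\<close>
  form a subclone \<open>?D\<close>, and \<open>f\<close> belongs to it.\<close>

lemma generated_3_subset:
  assumes f: "f \<in> ops C 3" and S: "S \<subseteq> ops C 3" "trivial_ops C 3 \<subseteq> S"
    and closed: "\<And>a b c. a \<in> S \<Longrightarrow> b \<in> S \<Longrightarrow> c \<in> S \<Longrightarrow> app3 3 f a b c \<in> S"
  shows "generated C 3 f 3 \<subseteq> S"
proof -
  let ?D = "\<lambda>n. {h \<in> ops C n. \<forall>gs\<in>tuples S n. clone_comp C n 3 h gs \<in> S}"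
  have S': "gs \<in> tuples (ops C 3) n" if "gs \<in> tuples S n" for gs n
    using that S by (auto simp: tuples_def)
  have "subclone C ?D"
    unfolding subclone_def
  proof (intro conjI allI impI)
    fix n i :: nat assume i: "1 \<le> i \<and> i \<le> n"
    have "clone_comp C n 3 (proj C n i) gs \<in> S" if "gs \<in> tuples S n" for gs
    proof -
      have "gs ! (i - 1) \<in> set gs" using i that by (auto simp: tuples_def)
      then show ?thesis using i that S'[OF that] by (auto simp: proj_comp tuples_def)
    qed
    then show "proj C n i \<in> ?D n" using i by (auto intro: proj_in)
  next
    fix n k :: nat and h gs
    assume *: "1 \<le> n \<and> 1 \<le> k \<and> h \<in> ?D n \<and> gs \<in> tuples (?D k) n"
    then have gs: "gs \<in> tuples (ops C k) n" by (auto simp: tuples_def)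
    have "clone_comp C k 3 (clone_comp C n k h gs) hs \<in> S" if hs: "hs \<in> tuples S k" for hs
    proof -
      have "map (\<lambda>g. clone_comp C k 3 g hs) gs \<in> tuples S n"
        using * hs by (auto simp: tuples_def)
      then show ?thesis using * hs gs by (auto simp: comp_assoc S')
    qed
    then show "clone_comp C n k h gs \<in> ?D k" using * gs by (auto intro: comp_in)
  qed auto
  moreover have "f \<in> ?D 3" using f closed by (auto simp: tuples_3_iff)
  ultimately have "generated C 3 f 3 \<subseteq> ?D 3" by (auto simp: generated_def)
  moreover have "h \<in> S" if "h \<in> ?D 3" for h
  proof -
    \<comment> \<open>A ternary operation is its own value at the three projections, which lie in
      \<open>S\<close>; so preserving \<open>S\<close> forces membership in
      \<open>S\<close>.\<close>
    have "[e1, e2, e3] \<in> tuples S 3" using S by (auto simp: tuples_3_iff trivial_ops_3)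
    with that have "app3 3 h e1 e2 e3 \<in> S" by blast
    then show ?thesis using that by simp
  qed
  ultimately show ?thesis by blast
qed

section \<open>Totally symmetric and absorbing majority operations\<close>

text \<open>A 3-cycle and a transposition generate \<open>S_3\<close>, so this is invariance under
  all permutations of the variables.\<close>

definition symmetric_majority :: "'a \<Rightarrow> bool" where
  "symmetric_majority f \<longleftrightarrow> is_majority C f \<and> cyclically_symmetric C f \<and> app3 3 f e2 e1 e3 = f"

lemma app3_cyclic:
  assumes "cyclically_symmetric C f" "f \<in> ops C 3" "k \<ge> 1" "a \<in> ops C k" "b \<in> ops C k" "c \<in> ops C k"
  shows "app3 k f b c a = app3 k f a b c"
proof -
  have "app3 k (app3 3 f e2 e3 e1) a b c = app3 k f b c a"
    using assms by (subst app3_assoc) auto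
  then show ?thesis using assms by (simp add: cyclically_symmetric_def)
qed

lemma app3_swap:
  assumes "app3 3 f e2 e1 e3 = f" "f \<in> ops C 3" "k \<ge> 1" "a \<in> ops C k" "b \<in> ops C k" "c \<in> ops C k"
  shows "app3 k f b a c = app3 k f a b c"
proof -
  have "app3 k (app3 3 f e2 e1 e3) a b c = app3 k f b a c"
    using assms(2-) by (subst app3_assoc) auto
  then show ?thesis using assms by simp
qed

text \<open>Majority settles repeated arguments. Three distinct arguments are either the three
  projections, with value \<open>f\<close>, or two projections and \<open>f\<close>, where
  \<open>abs\<close> and symmetry again give \<open>f\<close>.\<close>

lemma absorbing_app3:
  assumes f: "symmetric_majority f" and abs: "app3 3 f e1 e2 f = f"
    and S: "a \<in> {e1, e2, e3, f}" "b \<in> {e1, e2, e3, f}" "c \<in> {e1, e2, e3, f}"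
  shows "app3 3 f a b c = (if a = b \<or> a = c then a else if b = c then b else f)"
proof -
  have maj: "is_majority C f" and cyc: "cyclically_symmetric C f" and sw: "app3 3 f e2 e1 e3 = f"
    using f by (auto simp: symmetric_majority_def)
  have fin [simp]: "f \<in> ops C 3" using maj by (rule majority_in)
  have C: "app3 3 f q r p = app3 3 f p q r" and W: "app3 3 f q p r = app3 3 f p q r"
    if "p \<in> ops C 3" "q \<in> ops C 3" "r \<in> ops C 3" for p q r
    using that app3_cyclic[OF cyc fin, of 3] app3_swap[OF sw fin, of 3] by auto
  have abs2: "app3 3 f e2 e3 f = f"
  proof -
    \<comment> \<open>Rotating the variables turns \<open>abs\<close> into the same identity for the
      next pair of projections, because \<open>f\<close> is fixed by the rotation.\<close>
    have "app3 3 (app3 3 f e1 e2 f) e2 e3 e1 = app3 3 f e2 e3 (app3 3 f e2 e3 e1)"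
      by (subst app3_assoc) auto
    then show ?thesis using abs cyc by (simp add: cyclically_symmetric_def)
  qed
  have abs3: "app3 3 f e3 e1 f = f"
  proof -
    have "app3 3 (app3 3 f e2 e3 f) e2 e3 e1 = app3 3 f e3 e1 (app3 3 f e2 e3 e1)"
      by (subst app3_assoc) auto
    then show ?thesis using abs2 cyc by (simp add: cyclically_symmetric_def)
  qed
  have all: "app3 3 f p q r = f \<and> app3 3 f q r p = f \<and> app3 3 f r p q = f \<and>
      app3 3 f q p r = f \<and> app3 3 f p r q = f \<and> app3 3 f r q p = f"
    if "app3 3 f p q r = f" "p \<in> ops C 3" "q \<in> ops C 3" "r \<in> ops C 3" for p q r
    using that C W by metis
  note T = all[OF abs e_in(1,3) fin] all[OF abs2 e_in(3,4) fin] all[OF abs3 e_in(4,1) fin]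
    all[OF app3_id(1)[OF fin] e_in(1,3,4)]
  have abc: "a \<in> ops C 3" "b \<in> ops C 3" "c \<in> ops C 3" using S by auto
  consider "a = b" | "a = c" | "b = c" | "a \<noteq> b" "a \<noteq> c" "b \<noteq> c" by blast
  then show ?thesis
  proof cases
    case 4
    \<comment> \<open>\<open>T\<close> covers all 24 ordered choices of three different members of
      the list \<open>e1\<close>, \<open>e2\<close>, \<open>e3\<close>, \<open>f\<close>; every
      other choice contradicts distinctness.\<close>
    with S have "app3 3 f a b c = f"
      by (elim insertE emptyE) (simp_all only: T simp_thms)
    with 4 show ?thesis by simp
  qed (simp_all add: app3_majority[OF maj] abc)
qed

lemma generated_3_absorbing:
  assumes f: "symmetric_majority f" and abs: "app3 3 f e1 e2 f = f"
  shows "generated C 3 f 3 = {e1, e2, e3, f}"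
proof
  have fin: "f \<in> ops C 3" using f by (simp add: symmetric_majority_def is_majority_def)
  show "generated C 3 f 3 \<subseteq> {e1, e2, e3, f}"
    using absorbing_app3[OF f abs] fin by (intro generated_3_subset) (auto simp: trivial_ops_3)
  show "{e1, e2, e3, f} \<subseteq> generated C 3 f 3"
    using subclone_generated[OF fin] by (auto simp: subclone_def)
qed

text \<open>At \<open>(x, x, y)\<close>, \<open>(x, y, x)\<close> and \<open>(y, x, x)\<close> a
  majority operation always returns \<open>x\<close>, while each projection returns \<open>y\<close>
  at exactly one of these, a different one for each.\<close>

lemma distinct_e_majority:
  assumes ne: "proj C 2 1 \<noteq> proj C 2 2" and f: "is_majority C f"
  shows "distinct [e1, e2, e3, f]"
proof -
  let ?x = "proj C 2 1" and ?y = "proj C 2 2"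
  have xy: "?x \<in> ops C 2" "?y \<in> ops C 2" by (auto intro: proj_in)
  have *: "app3 2 e1 p q r = p" "app3 2 e2 p q r = q" "app3 2 e3 p q r = r"
    if "{p, q, r} \<subseteq> {?x, ?y}" for p q r
    using that xy by (intro app3_e; auto)+
  have "app3 2 f ?x ?x ?y = ?x" "app3 2 f ?x ?y ?x = ?x" "app3 2 f ?y ?x ?x = ?x"
    using app3_majority[OF f _ xy] by auto
  with ne * [of ?x ?x ?y] * [of ?x ?y ?x] * [of ?y ?x ?x] show ?thesis
    by auto
qed

section \<open>Semigroups of majority operations\<close>

lemma is_majorityI:
  assumes "f \<in> ops C 3"
    and "\<And>x y. x \<in> ops C 2 \<Longrightarrow> y \<in> ops C 2 \<Longrightarrow>
      app3 2 f x x y = x \<and> app3 2 f x y x = x \<and> app3 2 f y x x = x"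
  shows "is_majority C f"
proof -
  have "proj C 2 1 \<in> ops C 2" "proj C 2 2 \<in> ops C 2" by (auto intro: proj_in)
  then show ?thesis using assms unfolding is_majority_def Let_def by blast
qed

lemma majority_permute:
  assumes f: "is_majority C f"
  shows "is_majority C (app3 3 f e1 e3 e2)"
  by (rule is_majorityI) (use f in \<open>simp_all add: app3_assoc majority_in app3_majority\<close>)

text \<open>Serves both products: \<open>b\<close> is a majority operation in the first and
  \<open>e2\<close> in the second. At each two-valued triple at least two of \<open>e1\<close>,
  \<open>b\<close>, \<open>c\<close> return the majority value, so \<open>f\<close> returns it
  too.\<close>

lemma majority_comp_majority:
  assumes f: "is_majority C f" and b: "b = e2 \<or> is_majority C b" and c: "is_majority C c"
  shows "is_majority C (app3 3 f e1 b c)"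
proof (rule is_majorityI)
  note fin = majority_in[OF f] and cin = majority_in[OF c]
  have bin: "b \<in> ops C 3" using b majority_in by auto
  show "app3 3 f e1 b c \<in> ops C 3" using fin bin cin by simp
  fix x y assume xy: "x \<in> ops C 2" "y \<in> ops C 2"
  have "app3 2 b x x y = x" "app3 2 b x y x = x \<or> app3 2 b x y x = y" "app3 2 b y x x = x"
    using b xy by (auto simp: app3_majority)
  then show "app3 2 (app3 3 f e1 b c) x x y = x \<and> app3 2 (app3 3 f e1 b c) x y x = x \<and>
      app3 2 (app3 3 f e1 b c) y x x = x"
    using xy fin bin cin by (auto simp: app3_assoc app3_majority[OF f] app3_majority[OF c])
qed

lemma symmetric_majority_exists:
  assumes fin: "finite (ops C 3)" and ex: "\<exists>f. is_majority C f"
    and cyc: "\<And>f. is_majority C f \<Longrightarrow> cyclically_symmetric C f"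
  shows "\<exists>f. symmetric_majority f"
proof -
  let ?M = "{f. is_majority C f}"
  let ?m = "\<lambda>t g. app3 3 t e1 g (app3 3 g e1 e3 e2)"
  have "\<exists>g\<in>?M. ?m g g = g"
  proof (rule finite_semigroup_idempotent[where m = ?m])
    show "finite ?M" using fin by (rule rev_finite_subset) (auto dest: majority_in)
    show "?M \<noteq> {}" using ex by simp
    show "?m t g \<in> ?M" if "t \<in> ?M" "g \<in> ?M" for t g
    proof -
      have "is_majority C (app3 3 g e1 e3 e2)"
        using that by (intro majority_permute) simp
      with that show ?thesis using majority_comp_majority[of t g] by simp
    qed
    \<comment> \<open>Exchanging the last two variables of \<open>?m t g\<close> exchanges the last
      two arguments of \<open>t\<close>; this makes the product associative.\<close>
    show "?m (?m t g) h = ?m t (?m g h)" if "t \<in> ?M" "g \<in> ?M" "h \<in> ?M" for t g h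
      using that by (simp add: app3_assoc majority_in)
  qed
  then obtain g where g: "is_majority C g" and idem: "?m g g = g" by auto
  note gin [simp] = majority_in[OF g]
  \<comment> \<open>The \<open>u\<close> of the overview is \<open>g\<close> itself, being its own
    value at \<open>e1\<close>, \<open>e2\<close>, \<open>e3\<close>; the decisive evaluation is at
    \<open>(v, e1, g)\<close>.\<close>
  define v where "v = app3 3 g e1 e3 e2"
  have vin [simp]: "v \<in> ops C 3" by (simp add: v_def)
  have C: "app3 3 g q r p = app3 3 g p q r"
    if "p \<in> ops C 3" "q \<in> ops C 3" "r \<in> ops C 3" for p q r
    using that app3_cyclic[OF cyc[OF g] gin, of 3] by auto
  have I: "app3 3 g p (app3 3 g p q r) (app3 3 g p r q) = app3 3 g p q r"
    if "p \<in> ops C 3" "q \<in> ops C 3" "r \<in> ops C 3" for p q r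
  proof -
    have "app3 3 (?m g g) p q r = app3 3 g p (app3 3 g p q r) (app3 3 g p r q)"
      using that by (simp add: app3_assoc)
    with idem show ?thesis by simp
  qed
  have gv: "app3 3 g e1 g v = g" using idem by (simp add: v_def)
  have vg: "app3 3 g e1 v g = v" using I[of e1 e3 e2] by (simp add: v_def)
  have "app3 3 g v e1 g = g" using C[of v e1 g] gv by simp
  moreover have "app3 3 g v g e1 = v" using C[of e1 v g] vg by simp
  ultimately have "app3 3 g v g v = g" using I[of v e1 g] by simp
  then have "v = g" using app3_majority[OF g, of 3 v g] by simp
  \<comment> \<open>\<open>v = g\<close> is invariance under exchanging the last two variables; a
    cyclic shift turns it into exchanging the first two.\<close>
  then have "app3 3 g e2 e1 e3 = g" using C[of e2 e1 e3] by (simp add: v_def)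
  then show ?thesis using g cyc by (auto simp: symmetric_majority_def)
qed

lemma absorbing_majority_exists:
  assumes fin: "finite (ops C 3)" and ex: "\<exists>f. is_majority C f"
    and cyc: "\<And>f. is_majority C f \<Longrightarrow> cyclically_symmetric C f"
  shows "\<exists>f. symmetric_majority f \<and> app3 3 f e1 e2 f = f"
proof -
  let ?M = "{f. symmetric_majority f}"
  let ?m = "\<lambda>t g. app3 3 t e1 e2 g"
  have ops: "f \<in> ops C 3" if "symmetric_majority f" for f
    using that by (simp add: symmetric_majority_def majority_in)
  have "\<exists>g\<in>?M. ?m g g = g"
  proof (rule finite_semigroup_idempotent[where m = ?m])
    show "finite ?M" using fin by (rule rev_finite_subset) (auto dest: ops)
    show "?M \<noteq> {}" using symmetric_majority_exists[OF assms] by simp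
    show "?m t g \<in> ?M" if "t \<in> ?M" "g \<in> ?M" for t g
    proof -
      have "is_majority C (?m t g)"
        using that by (intro majority_comp_majority) (auto simp: symmetric_majority_def)
      \<comment> \<open>Exchanging the first two variables fixes \<open>g\<close> and swaps
        \<open>e1\<close> with \<open>e2\<close>, which the symmetry of \<open>t\<close> undoes.
        Cyclic symmetry holds by \<open>cyc\<close>, since the product is a majority
        operation.\<close>
      moreover have "app3 3 (?m t g) e2 e1 e3 = ?m t g"
      proof -
        have "app3 3 (?m t g) e2 e1 e3 = app3 3 t e2 e1 g"
          using that ops by (auto simp: app3_assoc symmetric_majority_def)
        also have "\<dots> = ?m t g"
          using that ops by (intro app3_swap) (auto simp: symmetric_majority_def)
        finally show ?thesis .
      qed
      ultimately show ?thesis using cyc by (auto simp: symmetric_majority_def)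
    qed
    show "?m (?m t g) h = ?m t (?m g h)" if "t \<in> ?M" "g \<in> ?M" "h \<in> ?M" for t g h
      using that by (simp add: app3_assoc ops)
  qed
  then show ?thesis by auto
qed

section \<open>Distinctness of the binary projections\<close>

text \<open>If the two coincided, substituting \<open>f\<close> and a projection into them would
  identify every \<open>f\<close> with that projection and make the clone trivial.\<close>

lemma proj_2_neq:
  assumes "trivial_ops C \<noteq> ops C"
  shows "proj C 2 1 \<noteq> proj C 2 2"
proof
  assume eq: "proj C 2 1 = proj C 2 2"
  have "f = proj C n 1" if "f \<in> ops C n" for f n
  proof -
    have n: "n \<ge> 1" using that no_nullary by (cases n) auto
    have "[f, proj C n 1] \<in> tuples (ops C n) 2"
      using that n by (auto simp: tuples_def intro: proj_in)
    then have "clone_comp C 2 n (proj C 2 1) [f, proj C n 1] = f"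
      "clone_comp C 2 n (proj C 2 2) [f, proj C n 1] = proj C n 1"
      using n by (simp_all add: proj_comp)
    with eq show ?thesis by simp
  qed
  \<comment> \<open>Arity 0 has to be excluded because \<open>trivial_ops C 0\<close> is
    empty.\<close>
  moreover have "n \<ge> 1" if "f \<in> ops C n" for f n
    using that no_nullary by (cases n) auto
  ultimately have "ops C n \<subseteq> trivial_ops C n" for n
    by (force simp: trivial_ops_def)
  moreover have "trivial_ops C n \<subseteq> ops C n" for n
    by (auto simp: trivial_ops_def intro: proj_in)
  ultimately have "trivial_ops C = ops C" by (intro ext) blast
  with assms show False ..
qed

end

section \<open>Isomorphism of four-element ternary parts\<close>

text \<open>The hypotheses determine the whole composition table, so the bijection matching the
  named elements respects composition.\<close>

lemma ternary_isomorphic_absorbing: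
  assumes P: "distinct [t_e1 P, t_e2 P, t_e3 P, f]" "t_carrier P = {t_e1 P, t_e2 P, t_e3 P, f}"
      "\<And>a b c. a \<in> t_carrier P \<Longrightarrow> b \<in> t_carrier P \<Longrightarrow> c \<in> t_carrier P \<Longrightarrow>
        t_comp P (t_e1 P) a b c = a \<and> t_comp P (t_e2 P) a b c = b \<and> t_comp P (t_e3 P) a b c = c \<and>
        t_comp P f a b c = (if a = b \<or> a = c then a else if b = c then b else f)"
    and Q: "distinct [t_e1 Q, t_e2 Q, t_e3 Q, g]" "t_carrier Q = {t_e1 Q, t_e2 Q, t_e3 Q, g}"
      "\<And>a b c. a \<in> t_carrier Q \<Longrightarrow> b \<in> t_carrier Q \<Longrightarrow> c \<in> t_carrier Q \<Longrightarrow>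
        t_comp Q (t_e1 Q) a b c = a \<and> t_comp Q (t_e2 Q) a b c = b \<and> t_comp Q (t_e3 Q) a b c = c \<and>
        t_comp Q g a b c = (if a = b \<or> a = c then a else if b = c then b else g)"
  shows "ternary_isomorphic P Q"
proof -
  define \<phi> where "\<phi> a = (if a = t_e1 P then t_e1 Q else if a = t_e2 P then t_e2 Q
    else if a = t_e3 P then t_e3 Q else g)" for a
  have \<phi>: "\<phi> (t_e1 P) = t_e1 Q" "\<phi> (t_e2 P) = t_e2 Q" "\<phi> (t_e3 P) = t_e3 Q" "\<phi> f = g"
    using P(1) by (auto simp: \<phi>_def)
  have inj: "inj_on \<phi> (t_carrier P)"
    using P(1) Q(1) unfolding P(2) by (simp add: \<phi>)
  have img: "\<phi> ` t_carrier P = t_carrier Q"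
    unfolding P(2) Q(2) by (simp add: \<phi>)
  have "\<phi> (t_comp P h a b c) = t_comp Q (\<phi> h) (\<phi> a) (\<phi> b) (\<phi> c)"
    if h: "h \<in> t_carrier P" and abc: "a \<in> t_carrier P" "b \<in> t_carrier P" "c \<in> t_carrier P" for h a b c
  proof -
    have q: "\<phi> a \<in> t_carrier Q" "\<phi> b \<in> t_carrier Q" "\<phi> c \<in> t_carrier Q"
      using abc img by auto
    \<comment> \<open>The table branches on equalities between arguments, so \<open>\<phi>\<close>
      has to reflect these as well as preserve them.\<close>
    have eq: "\<phi> a = \<phi> b \<longleftrightarrow> a = b" "\<phi> a = \<phi> c \<longleftrightarrow> a = c" "\<phi> b = \<phi> c \<longleftrightarrow> b = c"
      using inj abc by (auto dest: inj_onD)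
    show ?thesis using h P(3)[OF abc] Q(3)[OF q] unfolding P(2) by (auto simp: \<phi> eq)
  qed
  with \<phi> inj img show ?thesis
    unfolding ternary_isomorphic_def bij_betw_def by (intro exI[of _ \<phi>]) auto
qed

section \<open>The operation \<open>m1\<close>\<close>

lemma m1_apply:
  assumes "a \<in> {1, 2, 3}" "b \<in> {1, 2, 3}" "c \<in> {1, 2, 3}"
  shows "m1 [a, b, c] = (if a = b \<or> a = c then a else if b = c then b else 1)"
  using assms by (simp add: m1_def tuples_3_iff)

text \<open>Both sides are undefined outside the triples over the base set, so agreement on triples
  yields equality of functions.\<close>

lemma m1_ternary_eqI:
  assumes "\<And>a b c. a \<in> {1, 2, 3} \<Longrightarrow> b \<in> {1, 2, 3} \<Longrightarrow> c \<in> {1, 2, 3} \<Longrightarrow> F [a, b, c] = m1 [a, b, c]"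
  shows "restrict F (tuples {1, 2, 3} 3) = m1"
proof
  fix xs
  show "restrict F (tuples {1, 2, 3} 3) xs = m1 xs"
  proof (cases "xs \<in> tuples {1, 2, 3} 3")
    case True
    then obtain a b c where "xs = [a, b, c]" "a \<in> {1, 2, 3}" "b \<in> {1, 2, 3}" "c \<in> {1, 2, 3}"
      unfolding tuples_3_iff by blast
    with True assms[of a b c] show ?thesis by (simp only: restrict_apply if_True)
  next
    case False
    then show ?thesis by (simp only: restrict_apply m1_def if_False)
  qed
qed

lemma m1_comp_eqI:
  assumes "\<And>a b c. a \<in> {1, 2, 3} \<Longrightarrow> b \<in> {1, 2, 3} \<Longrightarrow> c \<in> {1, 2, 3} \<Longrightarrow>
    m1 [p [a, b, c], q [a, b, c], r [a, b, c]] = m1 [a, b, c]"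
  shows "clone_comp (full_clone {1, 2, 3}) 3 3 m1 [p, q, r] = m1"
proof -
  have "clone_comp (full_clone {1, 2, 3}) 3 3 m1 [p, q, r] =
      restrict (\<lambda>xs. m1 [p xs, q xs, r xs]) (tuples {1, 2, 3} 3)"
    by (simp only: full_clone_def clone.simps list.map)
  also have "\<dots> = m1" using assms by (rule m1_ternary_eqI)
  finally show ?thesis .
qed

lemma proj_full_clone_3:
  assumes "a \<in> A" "b \<in> A" "c \<in> A"
  shows "proj (full_clone A) 3 i [a, b, c] = [a, b, c] ! (i - 1)"
  using assms by (simp add: full_clone_def tuples_3_iff)

lemma symmetric_majority_m1: "abstract_clone.symmetric_majority (full_clone {1, 2, 3}) m1"
proof -
  interpret abstract_clone "full_clone {1, 2, 3 :: nat}" by (rule abstract_clone_full_clone)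
  show ?thesis
    unfolding symmetric_majority_def cyclically_symmetric_def
  proof (intro conjI is_majority_m1 m1_comp_eqI)
    fix a b c :: nat assume abc: "a \<in> {1, 2, 3}" "b \<in> {1, 2, 3}" "c \<in> {1, 2, 3}"
    show "m1 [e2 [a, b, c], e3 [a, b, c], e1 [a, b, c]] = m1 [a, b, c]"
      "m1 [e2 [a, b, c], e1 [a, b, c], e3 [a, b, c]] = m1 [a, b, c]"
      unfolding proj_full_clone_3[OF abc] using abc by (auto simp: m1_apply)
  qed
qed

text \<open>If \<open>a\<close>, \<open>b\<close>, \<open>c\<close> are distinct, the inner value is
  1, and \<open>m1 [a, b, 1]\<close> is 1 whether or not 1 is among \<open>a\<close>,
  \<open>b\<close>. Otherwise majority decides.\<close>

lemma absorbing_m1: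
  defines "F \<equiv> full_clone {1, 2, 3 :: nat}"
  shows "clone_comp F 3 3 m1 [proj F 3 1, proj F 3 2, m1] = m1"
  unfolding F_def
proof (rule m1_comp_eqI)
  fix a b c :: nat assume abc: "a \<in> {1, 2, 3}" "b \<in> {1, 2, 3}" "c \<in> {1, 2, 3}"
  show "m1 [proj (full_clone {1, 2, 3}) 3 1 [a, b, c], proj (full_clone {1, 2, 3}) 3 2 [a, b, c],
      m1 [a, b, c]] = m1 [a, b, c]"
    unfolding proj_full_clone_3[OF abc] using abc by (auto simp: m1_apply)
qed

section \<open>Uniqueness and comparison with \<open>m1\<close>\<close>

theorem theorem3p3:
  fixes C :: "'a clone"
  assumes "abstract_clone C"
    and "majority_clone C"
    and "minimal_clone C"
    and "finite (ops C 3)"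
    and "\<forall>f\<in>nontrivial_ops C 3. cyclically_symmetric C f"
  shows "(\<exists>!f. f \<in> nontrivial_ops C 3) \<and>
    ternary_isomorphic (ternary_part C) (ternary_part (concrete_clone_gen {1, 2, 3} 3 m1))"
proof -
  interpret abstract_clone C by fact
  interpret F: abstract_clone "full_clone {1, 2, 3 :: nat}" by (rule abstract_clone_full_clone)
  have ne: "proj C 2 1 \<noteq> proj C 2 2"
    using assms(3) by (intro proj_2_neq) (simp add: minimal_clone_def)
  have nontrivial: "f \<in> nontrivial_ops C 3" if "is_majority C f" for f
    using distinct_e_majority[OF ne that] majority_in[OF that]
    by (auto simp: nontrivial_ops_def trivial_ops_3)
  obtain f where f: "symmetric_majority f" and abs: "app3 3 f e1 e2 f = f"
    using absorbing_majority_exists assms(2,4,5) nontrivial by (auto simp: majority_clone_def)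
  have maj: "is_majority C f" using f by (simp add: symmetric_majority_def)
  have dist: "distinct [e1, e2, e3, f]" by (rule distinct_e_majority[OF ne maj])
  \<comment> \<open>By minimality \<open>f\<close> generates the trivial clone or everything; being
    nontrivial, it rules out the former.\<close>
  have "generated C 3 f \<in> {trivial_ops C, ops C}"
    using assms(3) subclone_generated(1)[OF majority_in[OF maj]] by (auto simp: minimal_clone_def)
  moreover have "f \<in> generated C 3 f 3" "f \<notin> trivial_ops C 3"
    using subclone_generated(2)[OF majority_in[OF maj]] nontrivial[OF maj]
    by (auto simp: nontrivial_ops_def)
  ultimately have "generated C 3 f = ops C" by auto
  then have ops3: "ops C 3 = {e1, e2, e3, f}"
    using generated_3_absorbing[OF f abs] by simp
  have "nontrivial_ops C 3 = {f}"
    using dist by (auto simp: nontrivial_ops_def trivial_ops_3 ops3)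
  moreover have "ternary_isomorphic (ternary_part C) (ternary_part (concrete_clone_gen {1, 2, 3} 3 m1))"
  proof (rule ternary_isomorphic_absorbing)
    let ?F = "full_clone {1, 2, 3 :: nat}"
    let ?Q = "ternary_part (concrete_clone_gen {1, 2, 3} 3 m1)"
    note abs1 = symmetric_majority_m1 absorbing_m1
    \<comment> \<open>\<open>concrete_clone_gen\<close> replaces only the carrier, so projections
      and composition remain those of the full clone, where the absorbing case computes what
      \<open>m1\<close> generates.\<close>
    have simpsQ: "t_e1 ?Q = F.e1" "t_e2 ?Q = F.e2" "t_e3 ?Q = F.e3"
      "t_comp ?Q = F.app3 3" "t_carrier ?Q = {F.e1, F.e2, F.e3, m1}"
      using F.generated_3_absorbing[OF abs1]
      by (auto simp: ternary_part_def concrete_clone_gen_def fun_eq_iff)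
    have ne1: "proj ?F 2 1 \<noteq> proj ?F 2 2"
      by (auto simp: full_clone_def fun_eq_iff tuples_def intro!: exI[of _ "[1, 2]"])
    show "distinct [t_e1 ?Q, t_e2 ?Q, t_e3 ?Q, m1]"
      unfolding simpsQ by (rule F.distinct_e_majority[OF ne1 is_majority_m1])
    show "t_carrier ?Q = {t_e1 ?Q, t_e2 ?Q, t_e3 ?Q, m1}" by (simp only: simpsQ)
    have m1: "m1 \<in> ops ?F 3" by (rule F.majority_in[OF is_majority_m1])
    show "t_comp ?Q (t_e1 ?Q) a b c = a \<and> t_comp ?Q (t_e2 ?Q) a b c = b \<and>
        t_comp ?Q (t_e3 ?Q) a b c = c \<and>
        t_comp ?Q m1 a b c = (if a = b \<or> a = c then a else if b = c then b else m1)"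
      if "a \<in> t_carrier ?Q" "b \<in> t_carrier ?Q" "c \<in> t_carrier ?Q" for a b c
    proof -
      have abc: "a \<in> {F.e1, F.e2, F.e3, m1}" "b \<in> {F.e1, F.e2, F.e3, m1}" "c \<in> {F.e1, F.e2, F.e3, m1}"
        using that by (simp_all only: simpsQ)
      then have "a \<in> ops ?F 3" "b \<in> ops ?F 3" "c \<in> ops ?F 3" using m1 F.e_in by blast+
      with F.absorbing_app3[OF abs1 abc] show ?thesis by (simp only: simpsQ F.app3_e)
    qed
    show "distinct [t_e1 (ternary_part C), t_e2 (ternary_part C), t_e3 (ternary_part C), f]"
      using dist by (simp add: ternary_part_def)
    show "t_carrier (ternary_part C) =
        {t_e1 (ternary_part C), t_e2 (ternary_part C), t_e3 (ternary_part C), f}"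
      using ops3 by (simp add: ternary_part_def)
    show "t_comp (ternary_part C) (t_e1 (ternary_part C)) a b c = a \<and>
        t_comp (ternary_part C) (t_e2 (ternary_part C)) a b c = b \<and>
        t_comp (ternary_part C) (t_e3 (ternary_part C)) a b c = c \<and>
        t_comp (ternary_part C) f a b c = (if a = b \<or> a = c then a else if b = c then b else f)"
      if "a \<in> t_carrier (ternary_part C)" "b \<in> t_carrier (ternary_part C)"
        "c \<in> t_carrier (ternary_part C)" for a b c
    proof -
      have "a \<in> ops C 3" "b \<in> ops C 3" "c \<in> ops C 3" using that by (auto simp: ternary_part_def)
      with absorbing_app3[OF f abs, of a b c] show ?thesis
        by (simp add: ternary_part_def ops3)
    qed
  qed
  ultimately show ?thesis by simp
qed

end
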